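(* Let $n,m\in\mathbb{N}$, let $A\in\mathbb{R}^{n\times n}$ be Hurwitz, and let $B\in\mathbb{R}^{n\times m}$, $C\in\mathbb{R}^{m\times n}$, $D\in\mathbb{R}^{m\times m}$ with $D+D^{\mathsf T}$ symmetric positive semi-definite. Let $M\in\mathbb{R}^{m\times m}$ be the square root of $D+D^{\mathsf T}$ (so $MM^{\mathsf T}=D+D^{\mathsf T}$). Let $\mathcal{P}$ be the controllability Gramian of the system $(A,B,C,D)$. For $L\in\mathbb{R}^{n\times m}$ define $$\widehat{C}(L)=B^{\mathsf T}\mathcal{L}^{-1}\big(-LL^{\mathsf T}\big)+ML^{\mathsf T},\qquad \mathcal{L}(X)=A^{\mathsf T}X+XA,$$ $$G(s)=C(sI_n-A)^{-1}B+D,\qquad \widehat{G}(s;L)=\widehat{C}(L)(sI_n-A)^{-1}B+D,$$ $$\mathcal{J}(L)=\big\|G-\widehat{G}(\cdot;L)\big\|_{\mathcal{H}_2}^2 .$$ Then $\mathcal{J}\colon\mathbb{R}^{n\times m}\to\mathbb{R}$ is differentiable, and for every $L\in\mathbb{R}^{n\times m}$ $$\mathcal{J}(L)=\operatorname{tr}\Big(\big(C-\widehat{C}(L)\big)\mathcal{P}\big(C^{\mathsf T}-\widehat{C}(L)^{\mathsf T}\big)\Big),$$ $$\nabla\mathcal{J}(L)=2\mathcal{X}L-2\mathcal{P}\big(C^{\mathsf T}-\widehat{C}(L)^{\mathsf T}\big)M,$$ where $\mathcal{X}\in\mathbb{R}^{n\times n}$ is the unique solution of the Lyapunov equation $$A\mathcal{X}+\mathcal{X}A^{\mathsf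 T}-\mathcal{P}\big(C^{\mathsf T}-\widehat{C}(L)^{\mathsf T}\big)B^{\mathsf T}-B\big(C-\widehat{C}(L)\big)\mathcal{P}=0 .$$
   Context: A real square matrix is Hurwitz if all its eigenvalues have negative real part. Since $A$ is Hurwitz, the Lyapunov operator $\mathcal{L}\colon\mathbb{R}^{n\times n}\to\mathbb{R}^{n\times n}$ is invertible. The controllability Gramian $\mathcal{P}$ is the unique (symmetric positive semi-definite) solution of $A\mathcal{P}+\mathcal{P}A^{\mathsf T}+BB^{\mathsf T}=0$. For a transfer function $H$ the $\mathcal{H}_2$-norm is given by $\|H\|_{\mathcal{H}_2}^2=\frac{1}{2\pi}\int_{-\infty}^{\infty}\|H(\mathrm{i}\omega)\|_{\mathrm F}^2\,\mathrm{d}\omega$, where $\|\cdot\|_{\mathrm F}$ is the Frobenius norm. The gradient $\nabla\mathcal{J}(L)\in\mathbb{R}^{n\times m}$ is taken with respect to the Frobenius inner product, i.e. the derivative of $\mathcal{J}$ at $L$ in direction $\Delta\in\mathbb{R}^{n\times m}$ is $\operatorname{tr}\big(\nabla\mathcal{J}(L)^{\mathsf T}\Delta\big)$. *)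

theory Defs
  imports "HOL-Analysis.Analysis"
begin

text \<open>Matrices with \<open>n\<close> rows and \<open>m\<close> columns have type \<open>real ^ 'm ^ 'n\<close>.\<close>

abbreviation cmatrix :: "real^'a^'b \<Rightarrow> complex^'a^'b" where
  "cmatrix X \<equiv> map_matrix of_real X"

definition hurwitz :: "real^'n^'n \<Rightarrow> bool" where
  "hurwitz A \<longleftrightarrow>
     (\<forall>(l::complex) (v::complex^'n). v \<noteq> 0 \<and> cmatrix A *v v = l *s v \<longrightarrow> Re l < 0)"

definition sym_psd :: "real^'n^'n \<Rightarrow> bool" where
  "sym_psd S \<longleftrightarrow> transpose S = S \<and> (\<forall>x. 0 \<le> x \<bullet> (S *v x))"

definition is_psd_sqrt :: "real^'n^'n \<Rightarrow> real^'n^'n \<Rightarrow> bool" where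
  "is_psd_sqrt M S \<longleftrightarrow> sym_psd M \<and> M ** M = S"

definition frobenius_norm :: "complex^'a^'b \<Rightarrow> real" where
  "frobenius_norm X = sqrt (\<Sum>i\<in>UNIV. \<Sum>j\<in>UNIV. (cmod (X $ i $ j))\<^sup>2)"

text \<open>The Bochner integral of a non-integrable function is \<open>0\<close>, so \<open>h2_norm H\<close> is the
  \<open>H\<^sub>2\<close>-norm only if \<open>h2_finite H\<close> holds.\<close>

definition h2_finite :: "(complex \<Rightarrow> complex^'a^'b) \<Rightarrow> bool" where
  "h2_finite H \<longleftrightarrow> integrable lborel (\<lambda>\<omega>::real. (frobenius_norm (H (\<i> * of_real \<omega>)))\<^sup>2)"

definition h2_norm :: "(complex \<Rightarrow> complex^'a^'b) \<Rightarrow> real" where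
  "h2_norm H = sqrt (1 / (2 * pi) * (LINT \<omega>|lborel. (frobenius_norm (H (\<i> * of_real \<omega>)))\<^sup>2))"

definition lyapunov_op :: "real^'n^'n \<Rightarrow> real^'n^'n \<Rightarrow> real^'n^'n" where
  "lyapunov_op A X = transpose A ** X + X ** A"

text \<open>For Hurwitz \<open>A\<close> the Lyapunov equation below has exactly one solution among all real
  square matrices, and that solution is symmetric positive semi-definite.\<close>

definition controllability_gramian :: "real^'n^'n \<Rightarrow> real^'m^'n \<Rightarrow> real^'n^'n" where
  "controllability_gramian A B =
     (THE P. A ** P + P ** transpose A + B ** transpose B = 0)"

definition transfer_function ::
  "real^'n^'n \<Rightarrow> real^'m^'n \<Rightarrow> real^'n^'p \<Rightarrow> real^'m^'p \<Rightarrow> complex \<Rightarrow> complex^'m^'p" where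
  "transfer_function A B C D s =
     cmatrix C ** matrix_inv (mat s - cmatrix A) ** cmatrix B + cmatrix D"

definition C_hat ::
  "real^'n^'n \<Rightarrow> real^'m^'n \<Rightarrow> real^'m^'m \<Rightarrow> real^'m^'n \<Rightarrow> real^'n^'m" where
  "C_hat A B M L =
     transpose B ** inv (lyapunov_op A) (- (L ** transpose L)) + M ** transpose L"

definition error_system ::
  "real^'n^'n \<Rightarrow> real^'m^'n \<Rightarrow> real^'n^'m \<Rightarrow> real^'m^'m \<Rightarrow> real^'m^'m \<Rightarrow> real^'m^'n
    \<Rightarrow> complex \<Rightarrow> complex^'m^'m" where
  "error_system A B C D M L s =
     transfer_function A B C D s - transfer_function A B (C_hat A B M L) D s"

definition objective ::
  "real^'n^'n \<Rightarrow> real^'m^'n \<Rightarrow> real^'n^'m \<Rightarrow> real^'m^'m \<Rightarrow> real^'m^'m \<Rightarrow> real^'m^'n \<Rightarrow> real" where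
  "objective A B C D M L = (h2_norm (error_system A B C D M L))\<^sup>2"

definition has_frobenius_gradient ::
  "(real^'m^'n \<Rightarrow> real) \<Rightarrow> real^'m^'n \<Rightarrow> real^'m^'n \<Rightarrow> bool" where
  "has_frobenius_gradient f V L \<longleftrightarrow>
     (f has_derivative (\<lambda>\<Delta>. trace (transpose V ** \<Delta>))) (at L)"

end

(*
  Write R(s) = (s - A)^-1. Since R(s) - I / (s + 1) is holomorphic on the closed right half-plane
  and of order 1 / |s|^2, Cauchy's theorem gives that the integral of Re R(i w) over the real line
  is pi I. This single identity yields both analytic facts about the Lyapunov equation.
  Uniqueness: A' X + X A = 0 implies (Re R_A'(i w)) X = - X (Re R_A(i w)), whence pi X = - pi X.
  The norm: the Gramian equation reads (i w - A) P + P (i w - A)^* = B B^T, so that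
  R B B^T R^* = P R^* + R P, and integration gives the trace formula.
  The gradient then follows by differentiating the trace formula and moving the inverse Lyapunov
  operator to the other factor of the trace (the adjoint equation for X).
*)
theory Submission
  imports Defs "HOL-Complex_Analysis.Cauchy_Integral_Theorem" "HOL-Probability.Sinc_Integral"
    "HOL-Real_Asymp.Real_Asymp"
begin

section \<open>Integrals along the imaginary axis\<close>

text \<open>The interval-integral facts recast over \<open>lborel\<close>. The function serves as
  dominating function and as Re (1 / (1 + i w)), the source of the constant pi.\<close>

lemma integrable_inverse_1_plus_square_UNIV:
  "integrable lborel (\<lambda>x::real. inverse (1 + x\<^sup>2))"
  and integral_inverse_1_plus_square_UNIV:
  "(LINT x|lborel. inverse (1 + x\<^sup>2)) = pi"
  using integrable_inverse_1_plus_square LBINT_inverse_1_plus_square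
  by (simp_all add: set_integrable_def interval_lebesgue_integral_def set_lebesgue_integral_def)

text \<open>The points i T and - i T are joined through the right half-plane by three sides of a
  rectangle. These sides have total length 4 T and stay at distance at least T from the origin, so
  the mean value inequality on each side suffices.\<close>

lemma norm_primitive_diff_imaginary_axis_le:
  fixes F f :: "complex \<Rightarrow> complex"
  assumes F: "\<And>s. Re s \<ge> 0 \<Longrightarrow> (F has_field_derivative f s) (at s within {s. Re s \<ge> 0})"
    and bd: "\<And>s. Re s \<ge> 0 \<Longrightarrow> norm (f s) \<le> K / (1 + (norm s)\<^sup>2)"
    and T: "T > 0" and K: "K \<ge> 0"
  shows "norm (F (\<i> * of_real T) - F (- (\<i> * of_real T))) \<le> 4 * T * (K / (1 + T\<^sup>2))"
proof -
  have seg: "norm (F a - F b) \<le> K / (1 + T\<^sup>2) * norm (a - b)"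
    if S: "\<And>z. z \<in> closed_segment a b \<Longrightarrow> Re z \<ge> 0 \<and> norm z \<ge> T" for a b
  proof (rule field_differentiable_bound[where S = "closed_segment a b" and f' = f])
    fix z assume z: "z \<in> closed_segment a b"
    show "(F has_field_derivative f z) (at z within closed_segment a b)"
      by (rule has_field_derivative_subset[OF F]) (use S z in auto)
    have "T\<^sup>2 \<le> (norm z)\<^sup>2" using S[OF z] T by (intro power_mono) auto
    hence "K / (1 + (norm z)\<^sup>2) \<le> K / (1 + T\<^sup>2)"
      using K by (intro divide_left_mono mult_pos_pos add_pos_nonneg) auto
    with bd[of z] S[OF z] show "norm (f z) \<le> K / (1 + T\<^sup>2)" by linarith
  qed auto
  \<comment> \<open>The corners of the rectangle; on each of the three sides used, one coordinate
    has absolute value T, which is what \<open>n1\<close> exploits.\<close>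
  let ?a = "Complex 0 T" and ?b = "Complex T T" and ?c = "Complex T (-T)" and ?d = "Complex 0 (-T)"
  have n1: "T \<le> norm z" if "Im z = T \<or> Im z = - T \<or> Re z = T" for z
    using that abs_Re_le_cmod[of z] abs_Im_le_cmod[of z] T by auto
  have ab: "norm (F ?a - F ?b) \<le> K / (1 + T\<^sup>2) * norm (?a - ?b)"
    using T by (intro seg conjI n1) (auto simp: closed_segment_def complex_eq_iff algebra_simps)
  have bc: "norm (F ?b - F ?c) \<le> K / (1 + T\<^sup>2) * norm (?b - ?c)"
    using T by (intro seg conjI n1) (auto simp: closed_segment_def complex_eq_iff algebra_simps)
  have dc: "norm (F ?d - F ?c) \<le> K / (1 + T\<^sup>2) * norm (?d - ?c)"
    using T by (intro seg conjI n1) (auto simp: closed_segment_def complex_eq_iff algebra_simps)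
  have lens: "norm (?a - ?b) = T" "norm (?b - ?c) = 2 * T" "norm (?d - ?c) = T"
    using T by (auto simp: cmod_def real_sqrt_mult)
  have "norm (F ?a - F ?d) \<le> norm (F ?a - F ?b) + norm (F ?b - F ?c) + norm (F ?c - F ?d)"
    using norm_triangle_ineq[of "F ?a - F ?b" "F ?b - F ?c"]
      norm_triangle_ineq[of "F ?a - F ?c" "F ?c - F ?d"] by simp
  also have "\<dots> \<le> 4 * T * (K / (1 + T\<^sup>2))"
    using ab bc dc unfolding lens norm_minus_commute[of "F ?d"] by argo
  finally have "norm (F ?a - F ?d) \<le> 4 * T * (K / (1 + T\<^sup>2))" .
  moreover have "?a = \<i> * of_real T" "?d = - (\<i> * of_real T)"
    by (simp_all add: complex_eq_iff)
  ultimately show ?thesis by simp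
qed

text \<open>Cauchy's theorem for a half-plane: with a primitive F on this convex set, the integral
  over [-n, n] is (F(i n) - F(- i n)) / i, which is O(1 / n) by the rectangle bound. Dominated
  convergence lets n tend to infinity.\<close>

lemma integral_imaginary_axis_eq_0:
  fixes f :: "complex \<Rightarrow> complex"
  assumes hol: "f holomorphic_on {s. Re s \<ge> 0}"
    and bd: "\<And>s. Re s \<ge> 0 \<Longrightarrow> norm (f s) \<le> K / (1 + (norm s)\<^sup>2)"
  shows "has_bochner_integral lborel (\<lambda>\<omega>::real. f (\<i> * of_real \<omega>)) 0"
proof -
  let ?S = "{s. Re s \<ge> 0}" and ?g = "\<lambda>\<omega>::real. f (\<i> * of_real \<omega>)"
  have K: "K \<ge> 0" using bd[of 0] norm_ge_zero[of "f 0"] by (simp del: norm_ge_zero)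
  have contf: "continuous_on ?S f" by (rule holomorphic_on_imp_continuous_on[OF hol])
  have contg: "continuous_on X ?g" for X
    by (rule continuous_on_compose2[OF contf]) (auto intro!: continuous_intros)
  have [measurable]: "?g \<in> borel_measurable lborel"
    using borel_measurable_continuous_onI[OF contg] by simp
  have gbd: "norm (?g \<omega>) \<le> K * inverse (1 + \<omega>\<^sup>2)" for \<omega>
    using bd[of "\<i> * of_real \<omega>"] by (simp add: norm_mult divide_inverse)
  have int_bd: "integrable lborel (\<lambda>\<omega>. K * inverse (1 + \<omega>\<^sup>2))"
    using integrable_inverse_1_plus_square_UNIV by simp
  have int: "integrable lborel ?g"
    by (rule Bochner_Integration.integrable_bound[OF int_bd])
       (use gbd in \<open>auto intro!: AE_I2 order.trans[OF gbd]\<close>)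
  \<comment> \<open>The primitive theorem for convex sets asks for continuity on the closed
    half-plane but differentiability only in its interior, outside a finite set that is empty
    here.\<close>
  have diff: "f field_differentiable at x" if "x \<in> interior ?S - {}" for x
  proof (rule holomorphic_on_imp_differentiable_at)
    show "f holomorphic_on interior ?S"
      using holomorphic_on_subset[OF hol interior_subset] .
  qed (use that in auto)
  obtain F where F: "\<And>x. x \<in> ?S \<Longrightarrow> (F has_field_derivative f x) (at x within ?S)"
    by (rule holomorphic_convex_primitive[OF convex_halfspace_Re_ge finite.emptyI contf diff])
      (assumption, rule that)
  \<comment> \<open>The path w -> i w has velocity i, hence the division by i.\<close>
  have FTC: "(LINT \<omega>|lborel. indicator {-real n..real n} \<omega> *\<^sub>R ?g \<omega>)
      = (F (\<i> * of_real (real n)) - F (- (\<i> * of_real (real n)))) / \<i>" for n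
  proof -
    have "((\<lambda>\<omega>. F (\<i> * of_real \<omega>)/\<i>) has_vector_derivative ?g \<omega>) (at \<omega> within {-real n..real n})" for \<omega>
    proof -
      have 1: "((\<lambda>\<omega>::real. \<i> * of_real \<omega>) has_vector_derivative \<i>) (at \<omega> within {-real n..real n})"
        by (auto intro!: derivative_eq_intros)
      have "(F has_field_derivative f (\<i> * of_real \<omega>))
          (at (\<i> * of_real \<omega>) within (\<lambda>\<omega>::real. \<i> * of_real \<omega>) ` {-real n..real n})"
        by (rule has_field_derivative_subset[OF F]) auto
      from field_vector_diff_chain_within[OF 1 this]
      have "((\<lambda>\<omega>. F (\<i> * of_real \<omega>)) has_vector_derivative \<i> * ?g \<omega>) (at \<omega> within {-real n..real n})"
        by (simp add: o_def)
      from has_vector_derivative_divide[OF this, of \<i>] show ?thesis by simp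
    qed
    from integral_FTC_Icc[OF _ this contg] show ?thesis
      by (simp add: algebra_simps)
  qed
  have lim1: "(\<lambda>n. LINT \<omega>|lborel. indicator {-real n..real n} \<omega> *\<^sub>R ?g \<omega>) \<longlonglongrightarrow> integral\<^sup>L lborel ?g"
  proof (rule integral_dominated_convergence[OF _ _ int_bd])
    show "AE \<omega> in lborel. (\<lambda>n. indicator {-real n..real n} \<omega> *\<^sub>R ?g \<omega>) \<longlonglongrightarrow> ?g \<omega>"
    proof (rule AE_I2)
      fix \<omega> :: real
      have "\<forall>\<^sub>F n in sequentially. \<bar>\<omega>\<bar> \<le> real n"
        using eventually_ge_at_top[of "nat \<lceil>\<bar>\<omega>\<bar>\<rceil>"] by eventually_elim linarith
      hence "\<forall>\<^sub>F n in sequentially. indicator {-real n..real n} \<omega> *\<^sub>R ?g \<omega> = ?g \<omega>"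
        by eventually_elim (auto simp: indicator_def)
      thus "(\<lambda>n. indicator {-real n..real n} \<omega> *\<^sub>R ?g \<omega>) \<longlonglongrightarrow> ?g \<omega>"
        by (rule tendsto_eventually)
    qed
    show "AE \<omega> in lborel. norm (indicator {-real n..real n} \<omega> *\<^sub>R ?g \<omega>) \<le> K * inverse (1 + \<omega>\<^sup>2)" for n
      using gbd K by (auto intro!: AE_I2 simp: indicator_def)
  qed auto
  have "(\<lambda>n. LINT \<omega>|lborel. indicator {-real n..real n} \<omega> *\<^sub>R ?g \<omega>) \<longlonglongrightarrow> 0"
  proof (rule Lim_null_comparison)
    show "\<forall>\<^sub>F n in sequentially. norm (LINT \<omega>|lborel. indicator {-real n..real n} \<omega> *\<^sub>R ?g \<omega>)
        \<le> 4 * real n * (K / (1 + (real n)\<^sup>2))"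
      using eventually_gt_at_top[of 0]
    proof eventually_elim
      case (elim n)
      show ?case unfolding FTC norm_divide
        using norm_primitive_diff_imaginary_axis_le[OF F bd _ K, of "real n"] elim by auto
    qed
    show "(\<lambda>n. 4 * real n * (K / (1 + (real n)\<^sup>2))) \<longlonglongrightarrow> 0" by real_asymp
  qed
  with lim1 have "integral\<^sup>L lborel ?g = 0" by (rule LIMSEQ_unique)
  with int show ?thesis by (simp add: has_bochner_integral_iff)
qed

section \<open>The resolvent of a Hurwitz matrix\<close>

lemma bounded_bilinear_matrix_matrix_mult:
  "bounded_bilinear ((**) :: ('a::{euclidean_space, real_normed_algebra_1})^'n^'m \<Rightarrow> 'a^'p^'n \<Rightarrow> 'a^'p^'m)"
  unfolding bilinear_conv_bounded_bilinear[symmetric] bilinear_def linear_iff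
  by (simp add: matrix_matrix_mult_def vec_eq_iff sum.distrib distrib_left distrib_right
      scaleR_sum_right)

text \<open>Supplies distributivity, the product rule and the exchange of integral and product; the
  sort constraint covers real and complex matrices alike.\<close>

interpretation matrix_mult: bounded_bilinear
  "(**) :: ('a::{euclidean_space, real_normed_algebra_1})^'n^'m \<Rightarrow> 'a^'p^'n \<Rightarrow> 'a^'p^'m"
  by (rule bounded_bilinear_matrix_matrix_mult)

lemma transpose_add: "transpose (X + Y) = transpose X + transpose Y"
  and transpose_diff: "transpose (X - Y) = transpose X - transpose Y"
  and transpose_minus: "transpose (- X) = - transpose X"
  by (simp_all add: transpose_def vec_eq_iff)

lemma bounded_linear_transpose:
  "bounded_linear (transpose :: ('a::euclidean_space)^'n^'m \<Rightarrow> 'a^'m^'n)"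
  unfolding linear_conv_bounded_linear[symmetric] linear_iff
  by (simp add: transpose_def vec_eq_iff)

lemma bounded_linear_trace:
  "bounded_linear (trace :: ('a::{euclidean_space, real_normed_algebra_1})^'n^'n \<Rightarrow> 'a)"
  unfolding linear_conv_bounded_linear[symmetric] linear_iff
  by (simp add: trace_def sum.distrib scaleR_sum_right)

lemma trace_scaleR: "trace (c *\<^sub>R X) = c *\<^sub>R trace (X :: ('a::{euclidean_space, real_normed_algebra_1})^'n^'n)"
  and trace_minus: "trace (- X) = - trace X"
  by (simp_all add: trace_def scaleR_sum_right sum_negf)

lemma trace_transpose: "trace (transpose X) = trace X"
  by (simp add: trace_def transpose_def)

lemma cmatrix_add: "cmatrix (X + Y) = cmatrix X + cmatrix Y"
  and cmatrix_minus: "cmatrix (- X) = - cmatrix X"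
  and cmatrix_diff: "cmatrix (X - Y) = cmatrix X - cmatrix Y"
  and cmatrix_transpose: "cmatrix (transpose X) = transpose (cmatrix X)"
  by (simp_all add: vec_eq_iff transpose_def)

lemma cmatrix_mult: "cmatrix (X ** Y) = cmatrix X ** cmatrix Y"
  by (simp add: vec_eq_iff matrix_matrix_mult_def)

lemma Re_cmatrix_mult_left: "map_matrix Re (cmatrix X ** Y) = X ** map_matrix Re Y"
  by (simp add: vec_eq_iff matrix_matrix_mult_def)

lemma Re_cmatrix_mult_right: "map_matrix Re (Y ** cmatrix X) = map_matrix Re Y ** X"
  by (simp add: vec_eq_iff matrix_matrix_mult_def)

lemma mat_mult_commute: "mat s ** X = X ** mat (s :: 'a::comm_semiring_1)"
  by (simp add: vec_eq_iff matrix_matrix_mult_def mat_def if_distrib if_distribR mult.commute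
      cong: if_cong)

lemma mat_vector_mult: "mat s *v x = s *s (x :: 'a::semiring_1^'n)"
  by (simp add: mat_def matrix_vector_mult_def vec_eq_iff if_distrib if_distribR cong: if_cong)

lemma norm_vector_scalar_mult: "norm (s *s x) = norm s * norm (x :: complex^'n)"
  by (simp add: norm_vec_def norm_mult L2_set_right_distrib)

section \<open>Invertibility and holomorphy on the closed right half-plane\<close>

text \<open>\<open>matrix_inv\<close> is a choice of inverse, so the facts about it below assume
  \<open>Re s \<ge> 0\<close>, where the matrix is invertible.\<close>

definition resolvent :: "real^'n^'n \<Rightarrow> complex \<Rightarrow> complex^'n^'n" where
  "resolvent A s = matrix_inv (mat s - cmatrix A)"

text \<open>A nonzero kernel vector would be an eigenvector of A for the eigenvalue s, whose real
  part is not negative.\<close>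

lemma hurwitz_invertible:
  assumes "hurwitz A" "Re s \<ge> 0"
  shows "invertible (mat s - cmatrix A)"
proof -
  have "v = 0" if "(mat s - cmatrix A) *v v = 0" for v
  proof -
    have "cmatrix A *v v = s *s v"
      using that by (simp add: matrix_vector_mult_diff_rdistrib mat_vector_mult)
    then show ?thesis
      using assms unfolding hurwitz_def by (meson linorder_not_le)
  qed
  then show ?thesis
    by (simp add: invertible_left_inverse matrix_left_invertible_ker)
qed

lemma
  assumes "hurwitz A" "Re s \<ge> 0"
  shows resolvent_right_inverse: "(mat s - cmatrix A) ** resolvent A s = mat 1"
    and resolvent_left_inverse: "resolvent A s ** (mat s - cmatrix A) = mat 1"
  using someI_ex[OF hurwitz_invertible[OF assms, unfolded invertible_def]]
  by (simp_all add: resolvent_def matrix_inv_def)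

lemma resolvent_unique:
  assumes "hurwitz A" "Re s \<ge> 0" "X ** (mat s - cmatrix A) = mat 1"
  shows "X = resolvent A s"
  by (metis assms matrix_mul_assoc matrix_mul_lid matrix_mul_rid resolvent_right_inverse)

text \<open>Since A is real, conjugating the left inverse identity at s gives a left inverse at
  \<open>cnj s\<close>.\<close>

lemma resolvent_cnj:
  assumes "hurwitz A" "Re s \<ge> 0"
  shows "resolvent A (cnj s) = map_matrix cnj (resolvent A s)"
proof -
  have "map_matrix cnj (resolvent A s ** (mat s - cmatrix A)) = mat 1"
    unfolding resolvent_left_inverse[OF assms] by (simp add: vec_eq_iff mat_def)
  moreover have "map_matrix cnj (resolvent A s ** (mat s - cmatrix A))
      = map_matrix cnj (resolvent A s) ** (mat (cnj s) - cmatrix A)"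
    by (auto simp: vec_eq_iff matrix_matrix_mult_def mat_def intro!: sum.cong)
  ultimately show ?thesis
    using resolvent_unique[of A "cnj s"] assms by simp
qed

lemma column_resolvent:
  assumes "hurwitz A" "Re s \<ge> 0"
  shows "(mat s - cmatrix A) *v column j (resolvent A s) = axis j 1"
proof -
  have "(mat s - cmatrix A) *v column j (resolvent A s) = column j ((mat s - cmatrix A) ** resolvent A s)"
    by (simp add: vec_eq_iff column_def matrix_vector_mult_def matrix_matrix_mult_def)
  also have "\<dots> = axis j 1"
    unfolding resolvent_right_inverse[OF assms]
    by (simp add: vec_eq_iff column_def mat_def axis_def)
  finally show ?thesis .
qed

lemma holomorphic_on_det:
  fixes F :: "complex \<Rightarrow> complex^'n^'n"
  assumes "\<And>i j. (\<lambda>s. F s $ i $ j) holomorphic_on S"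
  shows "(\<lambda>s. det (F s)) holomorphic_on S"
  unfolding det_def by (intro holomorphic_intros assms)

text \<open>By Cramer's rule each entry is a quotient of determinants that are polynomial in s, and
  the denominator has no zero in the half-plane.\<close>

lemma holomorphic_resolvent:
  assumes "hurwitz A"
  shows "(\<lambda>s. resolvent A s $ k $ j) holomorphic_on {s. Re s \<ge> 0}"
proof -
  \<comment> \<open>Cramer's numerator: column k of s - A is replaced by the j-th unit
    vector.\<close>
  let ?N = "\<lambda>s. \<chi> i l. if l = k then axis j 1 $ i else (mat s - cmatrix A) $ i $ l"
  have nz: "det (mat s - cmatrix A) \<noteq> 0" if "Re s \<ge> 0" for s
    using hurwitz_invertible[OF assms that] by (simp add: invertible_det_nz)
  have holA: "(\<lambda>s. (mat s - cmatrix A) $ i $ l) holomorphic_on S" for i l S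
    by (cases "i = l") (auto simp: mat_def intro!: holomorphic_intros)
  have holN: "(\<lambda>s. ?N s $ i $ l) holomorphic_on S" for i l S
    using holA by (cases "l = k") (auto intro!: holomorphic_intros)
  have "(\<lambda>s. det (?N s) / det (mat s - cmatrix A)) holomorphic_on {s. Re s \<ge> 0}"
    using nz by (intro holomorphic_intros holomorphic_on_det holA holN) auto
  moreover have "resolvent A s $ k $ j = det (?N s) / det (mat s - cmatrix A)"
    if "Re s \<ge> 0" for s
  proof -
    have "column j (resolvent A s) $ k = det (?N s) / det (mat s - cmatrix A)"
      using cramer[OF nz[OF that], of "column j (resolvent A s)" "axis j 1"]
        column_resolvent[OF assms that, of j] by simp
    then show ?thesis by (simp add: column_def)
  qed
  ultimately show ?thesis
    using holomorphic_cong[OF refl, of "{s. Re s \<ge> 0}" "\<lambda>s. resolvent A s $ k $ j"] by simp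
qed

section \<open>Decay of the resolvent at infinity\<close>

text \<open>For large s, the column v satisfies s v = e_j + A v, which forces |s| |v| to be at most
  2; the rest of the half-plane is compact. The weight is s + 1 rather than s because the leading
  term 1 / (s + 1) has no pole in the half-plane.\<close>

lemma resolvent_decay:
  assumes "hurwitz A"
  shows "\<exists>K. \<forall>s. Re s \<ge> 0 \<longrightarrow> norm (resolvent A s $ k $ j) * norm (s + 1) \<le> K"
proof -
  obtain a where a: "a > 0" "\<And>x. norm (cmatrix A *v x) \<le> norm x * a"
    using bounded_linear.pos_bounded[OF matrix_vector_mul_bounded_linear[of "cmatrix A"]] by blast
  \<comment> \<open>Beyond r the term \<open>norm v * a\<close> is at most half of
    \<open>norm v * norm s\<close>, and also \<open>norm (s + 1) \<le> 2 * norm s\<close>.\<close>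
  define r where "r = 2 * a + 1"
  have large: "norm (resolvent A s $ k $ j) * norm (s + 1) \<le> 4" if s: "Re s \<ge> 0" "norm s > r" for s
  proof -
    define v where "v = column j (resolvent A s)"
    have "s *s v = axis j 1 + cmatrix A *v v"
      using column_resolvent[OF assms s(1), of j]
      by (simp add: v_def matrix_vector_mult_diff_rdistrib mat_vector_mult algebra_simps)
    hence "norm s * norm v \<le> 1 + norm v * a"
      using norm_triangle_ineq[of "axis j (1::complex)" "cmatrix A *v v"] a(2)[of v]
      by (simp flip: norm_vector_scalar_mult)
    moreover have "norm v * (2 * a + 1) \<le> norm v * norm s"
      using s by (intro mult_left_mono) (auto simp: r_def)
    ultimately have "norm v * norm s \<le> 2"
      using norm_ge_zero[of v] by (auto simp: algebra_simps simp del: norm_ge_zero)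
    moreover have "norm (s + 1) \<le> 2 * norm s"
      using norm_triangle_ineq[of s 1] s a by (simp add: r_def)
    moreover have "norm (resolvent A s $ k $ j) \<le> norm v"
      using Finite_Cartesian_Product.norm_nth_le[of v k] by (simp add: v_def column_def)
    ultimately show ?thesis
      using mult_mono[of "norm (resolvent A s $ k $ j)" "norm v" "norm (s + 1)" "2 * norm s"]
      by simp
  qed
  have "compact ({s. Re s \<ge> 0} \<inter> cball 0 r)"
    by (intro closed_Int_compact closed_halfspace_Re_ge compact_cball)
  moreover have "continuous_on ({s. Re s \<ge> 0} \<inter> cball 0 r)
      (\<lambda>s. norm (resolvent A s $ k $ j) * norm (s + 1))"
    by (intro continuous_intros continuous_on_subset[OF holomorphic_on_imp_continuous_on[OF holomorphic_resolvent[OF assms]]]) auto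
  ultimately have "bounded ((\<lambda>s. norm (resolvent A s $ k $ j) * norm (s + 1)) ` ({s. Re s \<ge> 0} \<inter> cball 0 r))"
    using compact_continuous_image compact_imp_bounded by blast
  then obtain K where "\<And>s. Re s \<ge> 0 \<Longrightarrow> norm s \<le> r \<Longrightarrow> norm (resolvent A s $ k $ j) * norm (s + 1) \<le> K"
    unfolding bounded_iff by force
  with large show ?thesis
    by (intro exI[of _ "max 4 K"]) (metis linorder_not_le max.coboundedI1 max.coboundedI2)
qed

text \<open>From (s + 1) - (s - A) = 1 + A one gets R(s) - 1 / (s + 1) = R(s) (1 + A) / (s + 1), and
  R(s) contributes a second factor of order 1 / |s + 1|.\<close>

lemma resolvent_diff_decay:
  assumes "hurwitz A"
  obtains K where "\<And>s. Re s \<ge> 0 \<Longrightarrow>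
    norm (resolvent A s $ k $ j - mat 1 $ k $ j / (s + 1)) \<le> K / (1 + (norm s)\<^sup>2)"
proof -
  let ?I = "mat 1 + cmatrix A"
  obtain c where c: "\<And>l s. Re s \<ge> 0 \<Longrightarrow> norm (resolvent A s $ k $ l) * norm (s + 1) \<le> c l"
    using resolvent_decay[OF assms, of k] by metis
  define K where "K = (\<Sum>l\<in>UNIV. c l * norm (?I $ l $ j))"
  show ?thesis
  proof (rule that[of K])
    fix s :: complex assume s: "Re s \<ge> 0"
    have nz: "s + 1 \<noteq> 0" using s by (auto simp: complex_eq_iff)
    have "resolvent A s ** (mat (s + 1) - (mat s - cmatrix A)) = resolvent A s ** mat (s + 1) - mat 1"
      by (subst matrix_mult.diff_right) (simp add: resolvent_left_inverse[OF assms s])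
    moreover have "mat (s + 1) - (mat s - cmatrix A) = ?I"
      by (simp add: vec_eq_iff mat_def)
    ultimately have "resolvent A s ** mat (s + 1) - mat 1 = resolvent A s ** ?I"
      by simp
    hence "(resolvent A s ** mat (s + 1) - mat 1) $ k $ j = (resolvent A s ** ?I) $ k $ j"
      by simp
    hence *: "resolvent A s $ k $ j * (s + 1) - mat 1 $ k $ j = (\<Sum>l\<in>UNIV. resolvent A s $ k $ l * ?I $ l $ j)"
      by (simp add: matrix_matrix_mult_def mat_def if_distrib if_distribR cong: if_cong)
    \<comment> \<open>Multiplying by the square leaves one factor s + 1 for each resolvent entry,
      whose product with it is bounded by \<open>c l\<close>; this explains
      \<open>K\<close>.\<close>
    hence eq: "(resolvent A s $ k $ j - mat 1 $ k $ j / (s + 1)) * (s + 1)\<^sup>2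
        = (\<Sum>l\<in>UNIV. (resolvent A s $ k $ l * (s + 1)) * ?I $ l $ j)" (is "?d * _ = _")
    proof -
      have "?d * (s + 1)\<^sup>2 = (resolvent A s $ k $ j * (s + 1) - mat 1 $ k $ j) * (s + 1)"
        using nz by (simp add: power2_eq_square left_diff_distrib)
      also have "\<dots> = (\<Sum>l\<in>UNIV. resolvent A s $ k $ l * ?I $ l $ j) * (s + 1)"
        by (simp only: *)
      finally show ?thesis by (simp only: sum_distrib_right mult.assoc mult.commute[of "s + 1"])
    qed
    have "norm ?d * (norm (s + 1))\<^sup>2 = norm (?d * (s + 1)\<^sup>2)"
      by (simp add: norm_mult norm_power)
    also have "\<dots> \<le> K"
      unfolding eq K_def
      by (rule sum_norm_le) (use c[OF s] in \<open>auto simp: norm_mult intro!: mult_right_mono\<close>)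
    finally have "norm ?d * (norm (s + 1))\<^sup>2 \<le> K" .
    \<comment> \<open>The difference of the two sides is 2 Re s, which is nonnegative.\<close>
    moreover have "1 + (norm s)\<^sup>2 \<le> (norm (s + 1))\<^sup>2"
      using s unfolding cmod_power2 by (simp add: power2_eq_square algebra_simps)
    ultimately have "norm ?d * (1 + (norm s)\<^sup>2) \<le> K"
      by (meson mult_left_mono norm_ge_zero order.trans)
    thus "norm ?d \<le> K / (1 + (norm s)\<^sup>2)"
      by (simp add: pos_le_divide_eq add_pos_nonneg)
  qed
qed

section \<open>The integral of the real part of the resolvent\<close>

text \<open>The difference from 1 / (s + 1) integrates to 0, and Re (1 / (1 + i w)) = 1 / (1 + w^2)
  integrates to pi. Real parts are essential: the imaginary part of 1 / (1 + i w) decays only like 1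
  / w.\<close>

lemma has_bochner_integral_Re_resolvent_nth:
  assumes "hurwitz A"
  shows "has_bochner_integral lborel (\<lambda>\<omega>::real. Re (resolvent A (\<i> * of_real \<omega>) $ k $ j))
    ((pi *\<^sub>R mat 1 :: real^'n^'n) $ k $ j)"
proof -
  let ?f = "\<lambda>s. resolvent A s $ k $ j - mat 1 $ k $ j / (s + 1)"
  obtain K where "\<And>s. Re s \<ge> 0 \<Longrightarrow> norm (?f s) \<le> K / (1 + (norm s)\<^sup>2)"
    using resolvent_diff_decay[OF assms] by blast
  moreover have "?f holomorphic_on {s. Re s \<ge> 0}"
    by (intro holomorphic_intros holomorphic_resolvent assms) (auto simp: complex_eq_iff)
  ultimately have "has_bochner_integral lborel (\<lambda>\<omega>::real. ?f (\<i> * of_real \<omega>)) 0"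
    by (intro integral_imaginary_axis_eq_0)
  from has_bochner_integral_bounded_linear[OF bounded_linear_Re this]
  have "has_bochner_integral lborel (\<lambda>\<omega>::real. Re (?f (\<i> * of_real \<omega>))) 0" by simp
  moreover have "has_bochner_integral lborel (\<lambda>\<omega>. mat 1 $ k $ j * inverse (1 + \<omega>\<^sup>2)) (mat 1 $ k $ j * pi)"
    using integrable_inverse_1_plus_square_UNIV integral_inverse_1_plus_square_UNIV
    by (intro has_bochner_integral_mult_right) (simp add: has_bochner_integral_iff)
  ultimately have "has_bochner_integral lborel (\<lambda>\<omega>::real. Re (?f (\<i> * of_real \<omega>)) +
      mat 1 $ k $ j * inverse (1 + \<omega>\<^sup>2)) (0 + mat 1 $ k $ j * pi)"
    by (rule has_bochner_integral_add)
  thus ?thesis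
    by (simp add: mat_def Re_divide inverse_eq_divide add.commute mult.commute cong: if_cong
        split: if_splits)
qed

text \<open>A vector is the sum of its coordinates placed on the axes. For matrices the rule is
  applied twice, to rows and then to entries.\<close>

lemma has_bochner_integral_vec_lambda:
  fixes f :: "'a \<Rightarrow> ('b::euclidean_space)^'n"
  assumes "\<And>i. has_bochner_integral M (\<lambda>x. f x $ i) (c $ i)"
  shows "has_bochner_integral M f c"
proof -
  have bl: "bounded_linear (axis i :: 'b \<Rightarrow> 'b^'n)" for i
    unfolding linear_conv_bounded_linear[symmetric] linear_iff
    by (auto simp: axis_def vec_eq_iff)
  have dec: "(\<Sum>i\<in>UNIV. axis i (x $ i)) = x" for x :: "'b^'n"
    by (auto simp: vec_eq_iff axis_def if_distrib cong: if_cong)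
  have "has_bochner_integral M (\<lambda>x. \<Sum>i\<in>UNIV. axis i (f x $ i)) (\<Sum>i\<in>UNIV. axis i (c $ i))"
    by (intro has_bochner_integral_sum has_bochner_integral_bounded_linear[OF bl] assms)
  thus ?thesis by (simp add: dec)
qed

lemma has_bochner_integral_Re_resolvent:
  assumes "hurwitz A"
  shows "has_bochner_integral lborel (\<lambda>\<omega>::real. map_matrix Re (resolvent A (\<i> * of_real \<omega>)))
    (pi *\<^sub>R mat 1)"
  using has_bochner_integral_Re_resolvent_nth[OF assms]
  by (intro has_bochner_integral_vec_lambda) simp

section \<open>Lyapunov equations, the norm and the gradient\<close>

text \<open>Transposition preserves the determinant of l - A, so the transpose has no eigenvalue l
  with nonnegative real part either.\<close>

lemma hurwitz_transpose:
  assumes "hurwitz A"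
  shows "hurwitz (transpose A)"
  unfolding hurwitz_def
proof (intro allI impI, rule ccontr)
  fix l :: complex and v
  assume v: "v \<noteq> 0 \<and> cmatrix (transpose A) *v v = l *s v" and l: "\<not> Re l < 0"
  have "mat l - cmatrix (transpose A) = transpose (mat l - cmatrix A)"
    by (simp add: transpose_diff cmatrix_transpose)
  hence "det (mat l - cmatrix (transpose A)) \<noteq> 0"
    using hurwitz_invertible[OF assms, of l] l by (simp add: invertible_det_nz)
  hence "inj ((*v) (mat l - cmatrix (transpose A)))"
    by (intro inj_matrix_vector_mult) (simp add: invertible_det_nz)
  moreover have "(mat l - cmatrix (transpose A)) *v v = (mat l - cmatrix (transpose A)) *v 0"
    using v by (simp only: matrix_vector_mult_diff_rdistrib mat_vector_mult) simp
  ultimately show False using v by (metis injD)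
qed

text \<open>For s = i w one has cnj s = - s, so the equation becomes (cnj s - A') X = - X (s - A).
  Multiplying by both resolvents and taking real parts gives the identity \<open>re\<close>; its
  integral reads pi X = - pi X.\<close>

lemma hurwitz_sylvester_eq_0:
  fixes X :: "real^'n^'m"
  assumes A: "hurwitz A" and A': "hurwitz A'" and eq: "A' ** X + X ** A = 0"
  shows "X = 0"
proof -
  let ?R = "\<lambda>A (\<omega>::real). resolvent A (\<i> * of_real \<omega>)"
  have re: "map_matrix Re (?R A' \<omega>) ** X = - (X ** map_matrix Re (?R A \<omega>))" for \<omega>
  proof -
    define s where "s = \<i> * of_real \<omega>"
    have s: "Re s = 0" "Re (cnj s) = 0" "cnj s = - s" by (simp_all add: s_def)
    have "cmatrix A' ** cmatrix X = - (cmatrix X ** cmatrix A)"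
    proof -
      have "cmatrix A' ** cmatrix X + cmatrix X ** cmatrix A = cmatrix (A' ** X + X ** A)"
        by (simp only: cmatrix_mult cmatrix_add)
      also have "\<dots> = 0" unfolding eq by (simp add: vec_eq_iff)
      finally show ?thesis by (simp add: eq_neg_iff_add_eq_0)
    qed
    moreover have "mat s ** cmatrix X = cmatrix X ** mat s"
      by (rule mat_mult_commute)
    moreover have "mat (cnj s) = - (mat s :: complex^'m^'m)"
      by (simp add: s vec_eq_iff mat_def)
    ultimately have eq': "(mat (cnj s) - cmatrix A') ** cmatrix X = - (cmatrix X ** (mat s - cmatrix A))"
      by (simp add: matrix_mult.diff_left matrix_mult.diff_right matrix_mult.minus_left)
    have "resolvent A' (cnj s) ** ((mat (cnj s) - cmatrix A') ** cmatrix X) ** resolvent A s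
        = resolvent A' (cnj s) ** (- (cmatrix X ** (mat s - cmatrix A))) ** resolvent A s"
      by (simp only: eq')
    moreover have "resolvent A' (cnj s) ** ((mat (cnj s) - cmatrix A') ** cmatrix X) ** resolvent A s
        = cmatrix X ** resolvent A s"
      using resolvent_left_inverse[OF A', of "cnj s"] s by (simp add: matrix_mul_assoc)
    moreover have "resolvent A' (cnj s) ** (- (cmatrix X ** (mat s - cmatrix A))) ** resolvent A s
        = - (resolvent A' (cnj s) ** cmatrix X)"
      using resolvent_right_inverse[OF A, of s] s
      by (simp add: matrix_mult.minus_left matrix_mult.minus_right flip: matrix_mul_assoc)
    ultimately have "cmatrix X ** resolvent A s = - (map_matrix cnj (resolvent A' s) ** cmatrix X)"
      using resolvent_cnj[OF A', of s] s by simp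
    \<comment> \<open>Taking real parts removes the conjugation and leaves the quantities whose
      integrals are known.\<close>
    hence "map_matrix Re (cmatrix X ** resolvent A s)
        = map_matrix Re (- (map_matrix cnj (resolvent A' s) ** cmatrix X))"
      by simp
    also have "\<dots> = - map_matrix Re (map_matrix cnj (resolvent A' s) ** cmatrix X)"
      by (simp add: vec_eq_iff)
    also have "\<dots> = - (map_matrix Re (resolvent A' s) ** X)"
      unfolding Re_cmatrix_mult_right by (simp add: vec_eq_iff matrix_matrix_mult_def)
    finally show ?thesis
      unfolding Re_cmatrix_mult_left s_def by simp
  qed
  have "has_bochner_integral lborel (\<lambda>\<omega>. map_matrix Re (?R A' \<omega>) ** X) ((pi *\<^sub>R mat 1) ** X)"
    by (rule has_bochner_integral_bounded_linear[OF matrix_mult.bounded_linear_left])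
       (rule has_bochner_integral_Re_resolvent[OF A'])
  moreover have "has_bochner_integral lborel (\<lambda>\<omega>. - (X ** map_matrix Re (?R A \<omega>))) (- (X ** (pi *\<^sub>R mat 1)))"
    by (rule has_bochner_integral_minus)
       (rule has_bochner_integral_bounded_linear[OF matrix_mult.bounded_linear_right
          has_bochner_integral_Re_resolvent[OF A]])
  ultimately have "(pi *\<^sub>R mat 1) ** X = - (X ** (pi *\<^sub>R mat 1))"
    unfolding re by (rule has_bochner_integral_eq)
  hence "pi *\<^sub>R X = - (pi *\<^sub>R X)"
    by (simp only: matrix_mult.scaleR_left matrix_mult.scaleR_right matrix_mul_lid matrix_mul_rid)
  hence "(pi + pi) *\<^sub>R X = 0"
    by (simp only: scaleR_left_distrib flip: eq_neg_iff_add_eq_0)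
  thus ?thesis by simp
qed

lemma linear_lyapunov_op: "linear (lyapunov_op A)"
  unfolding lyapunov_op_def[abs_def]
  by (rule bounded_linear.linear[OF bounded_linear_add[OF matrix_mult.bounded_linear_right
          matrix_mult.bounded_linear_left]])

text \<open>Injectivity is the Sylvester lemma with \<open>transpose A\<close> on the left;
  surjectivity follows in finite dimension. From here \<open>inv (lyapunov_op A)\<close> is a
  genuine inverse.\<close>

lemma bij_lyapunov_op:
  assumes "hurwitz A"
  shows "bij (lyapunov_op A)"
proof -
  have "inj (lyapunov_op A)"
    unfolding linear_injective_0[OF linear_lyapunov_op] lyapunov_op_def
    using hurwitz_sylvester_eq_0[OF assms hurwitz_transpose[OF assms]] by blast
  then show ?thesis
    using linear_injective_imp_surjective[OF linear_lyapunov_op] by (simp add: bij_def)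
qed

lemma lyapunov_op_inv:
  "hurwitz A \<Longrightarrow> lyapunov_op A (inv (lyapunov_op A) Y) = Y"
  by (rule surj_f_inv_f[OF bij_is_surj[OF bij_lyapunov_op]])

lemma lyapunov_op_eq_iff:
  "hurwitz A \<Longrightarrow> lyapunov_op A X = Y \<longleftrightarrow> X = inv (lyapunov_op A) Y"
  by (simp only: bij_inv_eq_iff[OF bij_lyapunov_op])

lemma bounded_linear_inv_lyapunov_op:
  assumes "hurwitz A"
  shows "bounded_linear (inv (lyapunov_op A))"
proof -
  have "inv (lyapunov_op A) X + inv (lyapunov_op A) Y = inv (lyapunov_op A) (X + Y)" for X Y
    by (rule iffD1[OF lyapunov_op_eq_iff[OF assms]])
      (simp only: linear_add[OF linear_lyapunov_op] lyapunov_op_inv[OF assms])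
  moreover have "c *\<^sub>R inv (lyapunov_op A) X = inv (lyapunov_op A) (c *\<^sub>R X)" for c X
    by (rule iffD1[OF lyapunov_op_eq_iff[OF assms]])
      (simp only: linear_cmul[OF linear_lyapunov_op] lyapunov_op_inv[OF assms])
  ultimately show ?thesis
    unfolding linear_conv_bounded_linear[symmetric] linear_iff by simp
qed

text \<open>The Lyapunov operator commutes with transposition, hence so does its inverse. Symmetric
  right-hand sides therefore have symmetric solutions.\<close>

lemma transpose_inv_lyapunov_op:
  assumes "hurwitz A"
  shows "transpose (inv (lyapunov_op A) Y) = inv (lyapunov_op A) (transpose Y)"
proof -
  have "lyapunov_op A (transpose (inv (lyapunov_op A) Y)) = transpose (lyapunov_op A (inv (lyapunov_op A) Y))"
    by (simp only: lyapunov_op_def transpose_add matrix_transpose_mul transpose_transpose add.commute)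
  also have "\<dots> = transpose Y"
    by (simp only: lyapunov_op_inv[OF assms])
  finally show ?thesis
    by (simp only: lyapunov_op_eq_iff[OF assms])
qed

text \<open>The Gramian equation is the Lyapunov equation of \<open>transpose A\<close>, so its
  definite description denotes the unique solution.\<close>

lemma controllability_gramian_eq:
  assumes "hurwitz A"
  shows "controllability_gramian A B = inv (lyapunov_op (transpose A)) (- (B ** transpose B))"
proof -
  have "A ** P + P ** transpose A + B ** transpose B = 0
      \<longleftrightarrow> P = inv (lyapunov_op (transpose A)) (- (B ** transpose B))" for P
    using lyapunov_op_eq_iff[OF hurwitz_transpose[OF assms], of P "- (B ** transpose B)"]
    by (simp add: lyapunov_op_def eq_neg_iff_add_eq_0)
  then show ?thesis
    by (simp add: controllability_gramian_def)
qed

lemma controllability_gramian_solves: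
  assumes "hurwitz A"
  shows "A ** controllability_gramian A B + controllability_gramian A B ** transpose A = - (B ** transpose B)"
  using lyapunov_op_inv[OF hurwitz_transpose[OF assms], of "- (B ** transpose B)"]
  by (simp add: controllability_gramian_eq[OF assms] lyapunov_op_def)

lemma transpose_controllability_gramian:
  assumes "hurwitz A"
  shows "transpose (controllability_gramian A B) = controllability_gramian A B"
  by (simp add: controllability_gramian_eq[OF assms] transpose_inv_lyapunov_op[OF hurwitz_transpose[OF assms]]
      transpose_minus matrix_transpose_mul)

section \<open>The trace formula for the H2 norm\<close>

lemma frobenius_norm_power2:
  "(frobenius_norm H)\<^sup>2 = Re (trace (H ** transpose (map_matrix cnj H)))"
proof -
  have "(cmod z)\<^sup>2 = Re (z * cnj z)" for z
    unfolding cmod_power2 by (simp add: power2_eq_square)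
  then show ?thesis
    unfolding frobenius_norm_def
    by (simp add: sum_nonneg trace_def matrix_matrix_mult_def transpose_def)
qed

text \<open>For imaginary s the Gramian equation says that B B^T is Z P + P Z', where Z = s - A and
  Z' is its conjugate transpose. Multiplying by R on the left and by the conjugate transpose of R on
  the right cancels Z and Z'.\<close>

lemma resolvent_gramian:
  assumes A: "hurwitz A" and s: "Re s = 0"
    and P: "A ** P + P ** transpose A = - (B ** transpose B)"
  shows "resolvent A s ** cmatrix B ** transpose (cmatrix B) ** transpose (map_matrix cnj (resolvent A s))
    = resolvent A s ** cmatrix P + cmatrix P ** transpose (map_matrix cnj (resolvent A s))"
proof -
  let ?R = "resolvent A s" and ?Z = "mat s - cmatrix A"
  let ?R' = "transpose (map_matrix cnj ?R)" and ?Z' = "- mat s - transpose (cmatrix A)"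
  have cs: "cnj s = - s" using s by (simp add: complex_eq_iff)
  have "mat (cnj s) - cmatrix A = - mat s - cmatrix A"
    by (simp add: cs vec_eq_iff mat_def)
  hence "transpose ?Z' ** map_matrix cnj ?R = mat 1"
    using resolvent_right_inverse[OF A, of "cnj s"] s resolvent_cnj[OF A, of s]
    by (simp add: transpose_diff transpose_minus)
  hence R': "?R' ** ?Z' = mat 1"
    by (metis matrix_transpose_mul transpose_mat transpose_transpose)
  hence Z': "?Z' ** ?R' = mat 1" by (simp add: matrix_left_right_inverse)
  have "cmatrix (A ** P + P ** transpose A) = - cmatrix (B ** transpose B)"
    by (simp add: P cmatrix_minus)
  hence BB: "cmatrix B ** transpose (cmatrix B)
      = - (cmatrix A ** cmatrix P) - cmatrix P ** transpose (cmatrix A)"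
    by (simp add: cmatrix_add cmatrix_mult cmatrix_transpose eq_neg_iff_add_eq_0 algebra_simps)
  have "mat s ** cmatrix P = cmatrix P ** mat s"
    by (rule mat_mult_commute)
  hence BB': "cmatrix B ** transpose (cmatrix B) = ?Z ** cmatrix P + cmatrix P ** ?Z'"
    unfolding BB by (simp add: matrix_mult.diff_left matrix_mult.diff_right matrix_mult.minus_right)
  have "?R ** cmatrix B ** transpose (cmatrix B) ** ?R'
      = ?R ** (cmatrix B ** transpose (cmatrix B)) ** ?R'"
    by (simp only: matrix_mul_assoc)
  also have "\<dots> = ?R ** (?Z ** cmatrix P + cmatrix P ** ?Z') ** ?R'"
    by (simp only: BB')
  also have "\<dots> = (?R ** ?Z) ** cmatrix P ** ?R' + ?R ** cmatrix P ** (?Z' ** ?R')"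
    by (simp only: matrix_mult.add_left matrix_mult.add_right matrix_mul_assoc)
  also have "\<dots> = cmatrix P ** ?R' + ?R ** cmatrix P"
    using resolvent_left_inverse[OF A, of s] s by (simp only: Z') simp
  finally show ?thesis by (simp only: add.commute)
qed

text \<open>The preceding identity makes the squared norm a real-linear function of Re R(i w), so
  integrating it only requires the value at pi times the identity.\<close>

lemma has_bochner_integral_frobenius_norm_resolvent:
  fixes A :: "real^'n^'n" and B :: "real^'m^'n" and E :: "real^'n^'p"
  assumes A: "hurwitz A"
    and P: "A ** P + P ** transpose A = - (B ** transpose B)"
  shows "has_bochner_integral lborel
    (\<lambda>\<omega>::real. (frobenius_norm (cmatrix E ** resolvent A (\<i> * of_real \<omega>) ** cmatrix B))\<^sup>2)
    (2 * pi * trace (E ** P ** transpose E))"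
proof -
  let ?N = "\<lambda>\<omega>::real. map_matrix Re (resolvent A (\<i> * of_real \<omega>))"
  \<comment> \<open>At pi times the identity both summands equal pi P; this yields the factor 2 pi
    that the H2 norm divides out.\<close>
  let ?T = "\<lambda>N. trace (E ** (N ** P + P ** transpose N) ** transpose E)"
  have "(frobenius_norm (cmatrix E ** resolvent A (\<i> * of_real \<omega>) ** cmatrix B))\<^sup>2 = ?T (?N \<omega>)"
    for \<omega> :: real
  proof -
    define R where "R = resolvent A (\<i> * of_real \<omega>)"
    have cnj: "map_matrix cnj (cmatrix E ** R ** cmatrix B) = cmatrix E ** map_matrix cnj R ** cmatrix B"
      by (simp add: vec_eq_iff matrix_matrix_mult_def)
    have "cmatrix E ** R ** cmatrix B ** transpose (map_matrix cnj (cmatrix E ** R ** cmatrix B))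
      = cmatrix E ** (R ** cmatrix B ** transpose (cmatrix B) ** transpose (map_matrix cnj R)) ** cmatrix (transpose E)"
      by (simp only: cnj matrix_transpose_mul matrix_mul_assoc cmatrix_transpose)
    also have "R ** cmatrix B ** transpose (cmatrix B) ** transpose (map_matrix cnj R)
      = R ** cmatrix P + cmatrix P ** transpose (map_matrix cnj R)"
      unfolding R_def by (rule resolvent_gramian[OF A _ P]) simp
    finally have "(frobenius_norm (cmatrix E ** R ** cmatrix B))\<^sup>2
      = trace (map_matrix Re (cmatrix E ** (R ** cmatrix P + cmatrix P ** transpose (map_matrix cnj R)) ** cmatrix (transpose E)))"
      unfolding frobenius_norm_power2 by (simp add: trace_def)
    also have "\<dots> = trace (E ** map_matrix Re (R ** cmatrix P + cmatrix P ** transpose (map_matrix cnj R)) ** transpose E)"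
      by (simp only: Re_cmatrix_mult_left Re_cmatrix_mult_right)
    also have "map_matrix Re (R ** cmatrix P + cmatrix P ** transpose (map_matrix cnj R))
      = map_matrix Re (R ** cmatrix P) + map_matrix Re (cmatrix P ** transpose (map_matrix cnj R))"
      by (simp add: vec_eq_iff)
    also have "\<dots> = map_matrix Re R ** P + P ** transpose (map_matrix Re R)"
      unfolding Re_cmatrix_mult_left Re_cmatrix_mult_right
      by (simp add: vec_eq_iff matrix_matrix_mult_def transpose_def)
    finally show ?thesis by (simp add: R_def)
  qed
  moreover have "bounded_linear ?T"
  proof -
    have "bounded_linear (\<lambda>N. N ** P + P ** transpose N)"
      by (rule bounded_linear_add[OF matrix_mult.bounded_linear_left
            bounded_linear_compose[OF matrix_mult.bounded_linear_right bounded_linear_transpose]])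
    from bounded_linear_compose[OF bounded_linear_trace bounded_linear_compose[OF
          matrix_mult.bounded_linear_left bounded_linear_compose[OF
            matrix_mult.bounded_linear_right this]]]
    show ?thesis .
  qed
  hence "has_bochner_integral lborel (\<lambda>\<omega>. ?T (?N \<omega>)) (?T (pi *\<^sub>R mat 1))"
    using has_bochner_integral_Re_resolvent[OF A] by (rule has_bochner_integral_bounded_linear)
  moreover have "?T (pi *\<^sub>R mat 1) = 2 * pi * trace (E ** P ** transpose E)"
    by (simp only: transpose_scalar transpose_mat matrix_mult.scaleR_left matrix_mult.scaleR_right
        matrix_mul_lid matrix_mul_rid matrix_mult.add_left matrix_mult.add_right trace_add trace_scaleR) simp
  ultimately show ?thesis by simp
qed

text \<open>Both systems share D, which cancels; what remains decays along the imaginary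
  axis.\<close>

lemma error_system_eq:
  "error_system A B C D M L s = cmatrix (C - C_hat A B M L) ** resolvent A s ** cmatrix B"
  by (simp add: error_system_def transfer_function_def resolvent_def cmatrix_diff matrix_mult.diff_left)

lemma
  assumes "hurwitz A"
  shows h2_finite_error_system: "h2_finite (error_system A B C D M L)"
    and objective_eq: "objective A B C D M L = trace ((C - C_hat A B M L)
      ** controllability_gramian A B ** transpose (C - C_hat A B M L))"
proof -
  let ?f = "\<lambda>\<omega>::real. (frobenius_norm (error_system A B C D M L (\<i> * of_real \<omega>)))\<^sup>2"
  let ?t = "trace ((C - C_hat A B M L) ** controllability_gramian A B ** transpose (C - C_hat A B M L))"
  have int: "has_bochner_integral lborel ?f (2 * pi * ?t)"
    unfolding error_system_eq
    by (rule has_bochner_integral_frobenius_norm_resolvent[OF assms controllability_gramian_solves[OF assms]])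
  from int show "h2_finite (error_system A B C D M L)"
    by (simp add: h2_finite_def has_bochner_integral_iff)
  \<comment> \<open>Squaring the root in \<open>h2_norm\<close> needs a nonnegative trace; its sign
    is read off the integral.\<close>
  have "0 \<le> integral\<^sup>L lborel ?f" by (rule Bochner_Integration.integral_nonneg) simp
  with int have "0 \<le> ?t"
    using pi_gt_zero by (auto simp: has_bochner_integral_iff zero_le_mult_iff)
  with int show "objective A B C D M L = ?t"
    by (simp add: objective_def h2_norm_def has_bochner_integral_iff)
qed

section \<open>Derivative of the objective and the adjoint equation\<close>

lemma has_derivative_C_hat:
  assumes "hurwitz A"
  shows "(C_hat A B M has_derivative (\<lambda>\<Delta>. transpose B **
      inv (lyapunov_op A) (- (\<Delta> ** transpose L + L ** transpose \<Delta>)) + M ** transpose \<Delta>)) (at L)"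
proof -
  have T: "(transpose has_derivative transpose) (at L)"
    by (rule bounded_linear_imp_has_derivative[OF bounded_linear_transpose])
  have "((\<lambda>L. - (L ** transpose L)) has_derivative (\<lambda>\<Delta>. - (L ** transpose \<Delta> + \<Delta> ** transpose L))) (at L)"
    by (rule has_derivative_minus[OF matrix_mult.FDERIV[OF has_derivative_ident T]])
  from has_derivative_add[OF
      bounded_linear.has_derivative[OF matrix_mult.bounded_linear_right
        bounded_linear.has_derivative[OF bounded_linear_inv_lyapunov_op[OF assms] this]]
      bounded_linear.has_derivative[OF matrix_mult.bounded_linear_right T]]
  show ?thesis
    unfolding C_hat_def[abs_def] by (simp only: add.commute)
qed

text \<open>The product rule gives two terms that are transposes of each other because P is
  symmetric, so their traces agree.\<close>

lemma has_derivative_trace_quadratic: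
  fixes E :: "'a::real_normed_vector \<Rightarrow> real^'n^'m" and P :: "real^'n^'n"
  assumes "(E has_derivative E') (at L)" and P: "transpose P = P"
  shows "((\<lambda>L. trace (E L ** P ** transpose (E L)))
    has_derivative (\<lambda>\<Delta>. 2 * trace (E' \<Delta> ** P ** transpose (E L)))) (at L)"
proof -
  have "((\<lambda>L. trace (E L ** P ** transpose (E L))) has_derivative
      (\<lambda>\<Delta>. trace (E L ** P ** transpose (E' \<Delta>) + E' \<Delta> ** P ** transpose (E L)))) (at L)"
    by (rule bounded_linear.has_derivative[OF bounded_linear_trace matrix_mult.FDERIV[OF
            bounded_linear.has_derivative[OF matrix_mult.bounded_linear_left assms(1)]
            bounded_linear.has_derivative[OF bounded_linear_transpose assms(1)]]])
  moreover have "trace (E L ** P ** transpose (E' \<Delta>)) = trace (E' \<Delta> ** P ** transpose (E L))" for \<Delta>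
  proof -
    have "trace (E L ** P ** transpose (E' \<Delta>)) = trace (transpose (E L ** P ** transpose (E' \<Delta>)))"
      by (simp only: trace_transpose)
    thus ?thesis by (simp only: matrix_transpose_mul P transpose_transpose matrix_mul_assoc)
  qed
  ultimately show ?thesis by (simp add: trace_add)
qed

text \<open>Under the pairing tr(Q X) the operators X -> A X + X A^T and
  \<open>lyapunov_op A\<close> are adjoint, by cyclicity of the trace.\<close>

lemma trace_lyapunov_adjoint:
  "trace (Q ** (A ** X + X ** transpose A)) = trace (lyapunov_op A Q ** X)"
proof -
  have "trace (Q ** (A ** X + X ** transpose A)) = trace (Q ** A ** X) + trace (Q ** X ** transpose A)"
    by (simp only: matrix_mult.add_right trace_add matrix_mul_assoc)
  also have "trace (Q ** X ** transpose A) = trace (transpose A ** Q ** X)"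
    by (simp only: trace_mul_sym[of _ "transpose A"] matrix_mul_assoc)
  finally show ?thesis
    by (simp only: lyapunov_op_def matrix_mult.add_left trace_add add.commute)
qed

text \<open>The left side is the directional derivative of the objective, in which \<Delta> enters Q
  through a Lyapunov equation. Pairing that equation with X makes the dependence on \<Delta>
  explicit.\<close>

lemma trace_gradient:
  fixes A X P Q :: "real^'n^'n" and B L \<Delta> :: "real^'m^'n" and E :: "real^'n^'m" and M :: "real^'m^'m"
  assumes P: "transpose P = P" and X: "transpose X = X" and Q: "transpose Q = Q" and M: "transpose M = M"
    and eqX: "A ** X + X ** transpose A = P ** transpose E ** transpose B + B ** E ** P"
    and eqQ: "lyapunov_op A Q = - (\<Delta> ** transpose L + L ** transpose \<Delta>)"
  shows "- (2 * trace ((transpose B ** Q + M ** transpose \<Delta>) ** P ** transpose E))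
    = trace (transpose (2 *\<^sub>R (X ** L) - 2 *\<^sub>R (P ** transpose E ** M)) ** \<Delta>)"
proof -
  have rotate: "trace (U ** V ** W) = trace (V ** W ** U)"
    for U :: "real^'a^'b" and V :: "real^'c^'a" and W :: "real^'b^'c"
    by (metis trace_mul_sym matrix_mul_assoc)
  \<comment> \<open>Facts \<open>1\<close> and \<open>2\<close> write one number in two ways; their
    sum pairs Q with the symmetric right-hand side of the equation for X.\<close>
  have 1: "trace (transpose B ** Q ** P ** transpose E) = trace (Q ** (P ** transpose E ** transpose B))"
    using rotate[of "transpose B" Q "P ** transpose E"] by (simp only: matrix_mul_assoc)
  have 2: "trace (transpose B ** Q ** P ** transpose E) = trace (Q ** (B ** E ** P))"
  proof -
    have "trace (transpose B ** Q ** P ** transpose E) = trace (transpose (transpose B ** Q ** P ** transpose E))"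
      by (simp only: trace_transpose)
    also have "\<dots> = trace (E ** P ** (Q ** B))"
      by (simp only: matrix_transpose_mul P Q transpose_transpose matrix_mul_assoc)
    also have "\<dots> = trace (Q ** (B ** E ** P))"
      using trace_mul_sym[of "E ** P" "Q ** B"] by (simp only: matrix_mul_assoc)
    finally show ?thesis .
  qed
  have 3: "trace (L ** transpose \<Delta> ** X) = trace (transpose L ** X ** \<Delta>)"
  proof -
    have "trace (L ** transpose \<Delta> ** X) = trace (transpose (L ** transpose \<Delta> ** X))"
      by (simp only: trace_transpose)
    also have "\<dots> = trace (X ** \<Delta> ** transpose L)"
      by (simp only: matrix_transpose_mul X transpose_transpose matrix_mul_assoc)
    finally show ?thesis using rotate[of "transpose L" X \<Delta>] by simp
  qed
  have 4: "trace (\<Delta> ** transpose L ** X) = trace (transpose L ** X ** \<Delta>)"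
    by (rule rotate)
  have "2 * trace (transpose B ** Q ** P ** transpose E) = trace (Q ** (A ** X + X ** transpose A))"
    unfolding eqX matrix_mult.add_right trace_add using 1 2 by simp
  also have "\<dots> = - (2 * trace (transpose L ** X ** \<Delta>))"
    unfolding trace_lyapunov_adjoint eqQ
    by (simp only: matrix_mult.minus_left matrix_mult.add_left trace_add trace_minus 3 4)
  finally have B: "2 * trace (transpose B ** Q ** P ** transpose E) = - (2 * trace (transpose L ** X ** \<Delta>))" .
  have C: "trace (M ** transpose \<Delta> ** P ** transpose E) = trace (M ** E ** P ** \<Delta>)"
  proof -
    have "trace (M ** transpose \<Delta> ** P ** transpose E) = trace (transpose (M ** transpose \<Delta> ** P ** transpose E))"
      by (simp only: trace_transpose)
    also have "\<dots> = trace (E ** P ** \<Delta> ** M)"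
      by (simp only: matrix_transpose_mul P M transpose_transpose matrix_mul_assoc)
    also have "\<dots> = trace (M ** E ** P ** \<Delta>)"
      using trace_mul_sym[of "E ** P ** \<Delta>" M] by (simp only: matrix_mul_assoc)
    finally show ?thesis .
  qed
  have "trace (transpose (2 *\<^sub>R (X ** L) - 2 *\<^sub>R (P ** transpose E ** M)) ** \<Delta>)
    = 2 * trace (transpose L ** X ** \<Delta>) - 2 * trace (M ** E ** P ** \<Delta>)"
    by (simp add: transpose_diff transpose_scalar matrix_transpose_mul P X M matrix_mult.diff_left
        matrix_mult.scaleR_left trace_sub trace_scaleR
        matrix_mul_assoc)
  with B C show ?thesis
    by (simp add: matrix_mult.add_left trace_add)
qed

theorem theorem3p2:
  fixes A :: "real^'n^'n" and B :: "real^'m^'n" and C :: "real^'n^'m"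
    and D M :: "real^'m^'m"
  assumes "hurwitz A"
    and "sym_psd (D + transpose D)"
    and "is_psd_sqrt M (D + transpose D)"
  shows "let P = controllability_gramian A B;
             J = objective A B C D M;
             Ch = C_hat A B M
         in (\<forall>L. h2_finite (error_system A B C D M L))
          \<and> (\<forall>L. J differentiable (at L))
          \<and> (\<forall>L. J L = trace ((C - Ch L) ** P ** (transpose C - transpose (Ch L))))
          \<and> (\<forall>L. \<exists>X :: real^'n^'n.
                (\<forall>Y. A ** Y + Y ** transpose A
                      - P ** (transpose C - transpose (Ch L)) ** transpose B
                      - B ** (C - Ch L) ** P = 0 \<longleftrightarrow> Y = X)
              \<and> has_frobenius_gradient J
                  (2 *\<^sub>R (X ** L) - 2 *\<^sub>R (P ** (transpose C - transpose (Ch L)) ** M)) L)"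
proof -
  note A = assms(1)
  note A' = hurwitz_transpose[OF A]
  define P where "P = controllability_gramian A B"
  define J where "J = objective A B C D M"
  define Ch where "Ch = C_hat A B M"
  define E where "E L = C - Ch L" for L
  have M: "transpose M = M"
    using assms(3) by (simp add: is_psd_sqrt_def sym_psd_def)
  have P: "transpose P = P"
    unfolding P_def by (rule transpose_controllability_gramian[OF A])
  have E_transpose: "transpose C - transpose (Ch L) = transpose (E L)" for L
    by (simp add: E_def transpose_diff)
  have J_eq: "J L = trace (E L ** P ** transpose (E L))" for L
    using objective_eq[OF A] by (simp add: J_def E_def Ch_def P_def)
  have grad: "\<exists>X. (\<forall>Y. A ** Y + Y ** transpose A - P ** transpose (E L) ** transpose B - B ** E L ** P = 0
        \<longleftrightarrow> Y = X)
      \<and> has_frobenius_gradient J (2 *\<^sub>R (X ** L) - 2 *\<^sub>R (P ** transpose (E L) ** M)) L" for L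
  proof -
    let ?Y = "P ** transpose (E L) ** transpose B + B ** E L ** P"
    define X where "X = inv (lyapunov_op (transpose A)) ?Y"
    \<comment> \<open>The derivative in direction \<Delta> of the Lyapunov solution with right-hand
      side - L L^T.\<close>
    define Q where "Q \<Delta> = inv (lyapunov_op A) (- (\<Delta> ** transpose L + L ** transpose \<Delta>))" for \<Delta>
    have iff: "A ** Y + Y ** transpose A - P ** transpose (E L) ** transpose B - B ** E L ** P = 0
        \<longleftrightarrow> Y = X" for Y
      using lyapunov_op_eq_iff[OF A', of Y ?Y] by (simp add: X_def lyapunov_op_def diff_diff_eq)
    have eqX: "A ** X + X ** transpose A = ?Y"
      using iff[of X] by (simp add: diff_diff_eq)
    \<comment> \<open>The two summands of \<open>?Y\<close> are transposes of each other.\<close>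
    have X: "transpose X = X"
      by (simp add: X_def transpose_inv_lyapunov_op[OF A'] transpose_add matrix_transpose_mul P
          matrix_mul_assoc add.commute)
    have Q: "transpose (Q \<Delta>) = Q \<Delta>" for \<Delta>
      by (simp only: Q_def transpose_inv_lyapunov_op[OF A] transpose_add transpose_minus
          matrix_transpose_mul transpose_transpose add.commute)
    have "(E has_derivative (\<lambda>\<Delta>. - (transpose B ** Q \<Delta> + M ** transpose \<Delta>))) (at L)"
      using has_derivative_diff[OF has_derivative_const has_derivative_C_hat[OF A]]
      unfolding E_def Ch_def Q_def by fastforce
    from has_derivative_trace_quadratic[OF this P]
    have "(J has_derivative (\<lambda>\<Delta>. - (2 * trace ((transpose B ** Q \<Delta> + M ** transpose \<Delta>) ** P ** transpose (E L))))) (at L)"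
      unfolding J_eq[abs_def] by (simp only: matrix_mult.minus_left trace_minus mult_minus_right)
    also have "(\<lambda>\<Delta>. - (2 * trace ((transpose B ** Q \<Delta> + M ** transpose \<Delta>) ** P ** transpose (E L))))
      = (\<lambda>\<Delta>. trace (transpose (2 *\<^sub>R (X ** L) - 2 *\<^sub>R (P ** transpose (E L) ** M)) ** \<Delta>))"
      by (intro ext trace_gradient[OF P X Q M eqX]) (simp add: Q_def lyapunov_op_inv[OF A])
    finally show ?thesis
      unfolding has_frobenius_gradient_def using iff by blast
  qed
  then have "J differentiable (at L)" for L
    unfolding has_frobenius_gradient_def differentiable_def by blast
  with grad J_eq h2_finite_error_system[OF A] show ?thesis
    unfolding Let_def P_def[symmetric] J_def[symmetric] Ch_def[symmetric] E_transpose E_def[symmetric]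
    by (intro conjI allI)
qed

end
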